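(* Let $X$ be a Banach space, let $T_1,\dots,T_n\in L(X)$ be finitely many pairwise commuting operators, and let $\mathfrak A\subseteq L(X)$ be the norm closed algebra generated by $T_1,\dots,T_n$. If there exists a half-space of $X$ that is almost invariant under every operator in $\mathfrak A$, then there exists a half-space of $X$ that is invariant under every operator in $\mathfrak A$.
   Context: $L(X)$ denotes the algebra of bounded linear operators on $X$. A half-space of $X$ is a norm closed linear subspace $Y\subseteq X$ of infinite dimension and infinite codimension. A closed subspace $Y$ is almost invariant under $T\in L(X)$ if there is a finite-dimensional subspace $F\subseteq X$ (depending on $T$) with $TY\subseteq Y+F$; it is invariant under $T$ if $TY\subseteq Y$. The norm closed algebra generated by a set of operators is the smallest norm closed subalgebra of $L(X)$ containing it. *)

theory Defs
  imports "HOL-Analysis.Analysis"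
begin

definition invariant :: "('a::real_normed_vector \<Rightarrow>\<^sub>L 'a) \<Rightarrow> 'a set \<Rightarrow> bool" where
  "invariant S Y \<longleftrightarrow> S ` Y \<subseteq> Y"

text \<open>
  Banach spaces over the reals and over the complex numbers are treated uniformly. A type of class
  \<open>real_normed_field\<close> is, by the Gelfand-Mazur theorem, isometrically isomorphic to the reals or to
  the complex numbers, and \<open>scl\<close> is the scalar multiplication on \<open>'a\<close>. The class \<open>banach\<close> supplies
  the complete norm and the underlying real structure, which \<open>scl\<close> has to extend.
\<close>

locale banach_space_over = vector_space scl
  for scl :: "'k::real_normed_field \<Rightarrow> 'a::banach \<Rightarrow> 'a" +
  assumes scl_of_real: "scl (of_real r) x = r *\<^sub>R x"
    and norm_scl: "norm (scl c x) = norm c * norm x"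
begin

text \<open>
  The algebra \<open>L(X)\<close>. The type \<open>'a \<Rightarrow>\<^sub>L 'a\<close> consists of the bounded real-linear operators, with the
  operator norm; linearity over \<open>'k\<close> has to be imposed.
\<close>

definition operators :: "('a \<Rightarrow>\<^sub>L 'a) set" where
  "operators = {S :: 'a \<Rightarrow>\<^sub>L 'a. \<forall>c x. S (scl c x) = scl c (S x)}"

definition scale_op :: "'k \<Rightarrow> ('a \<Rightarrow>\<^sub>L 'a) \<Rightarrow> ('a \<Rightarrow>\<^sub>L 'a)" where
  "scale_op c S = Blinfun (\<lambda>x. scl c (S x))"

text \<open>Subalgebras are not required to contain the identity operator.\<close>

definition subalgebra :: "('a \<Rightarrow>\<^sub>L 'a) set \<Rightarrow> bool" where
  "subalgebra A \<longleftrightarrow> A \<subseteq> operators \<and> 0 \<in> A \<and>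
     (\<forall>S\<in>A. \<forall>R\<in>A. S + R \<in> A \<and> S o\<^sub>L R \<in> A) \<and> (\<forall>c. \<forall>S\<in>A. scale_op c S \<in> A)"

definition closed_algebra_generated_by :: "('a \<Rightarrow>\<^sub>L 'a) set \<Rightarrow> ('a \<Rightarrow>\<^sub>L 'a) set" where
  "closed_algebra_generated_by G = \<Inter>{A. subalgebra A \<and> closed A \<and> G \<subseteq> A}"

definition finite_dim_subspace :: "'a set \<Rightarrow> bool" where
  "finite_dim_subspace F \<longleftrightarrow> (\<exists>B. finite B \<and> F = span B)"

text \<open>
  The quotient by \<open>Y\<close> is finite-dimensional iff the cosets of finitely many vectors \<open>B\<close> span it,
  that is, iff every vector is congruent modulo \<open>Y\<close> to an element of \<open>span B\<close>.
\<close>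

definition finite_codim :: "'a set \<Rightarrow> bool" where
  "finite_codim Y \<longleftrightarrow> (\<exists>B. finite B \<and> (\<forall>x. \<exists>b\<in>span B. x - b \<in> Y))"

definition half_space :: "'a set \<Rightarrow> bool" where
  "half_space Y \<longleftrightarrow> subspace Y \<and> closed Y \<and> \<not> finite_dim_subspace Y \<and> \<not> finite_codim Y"

definition almost_invariant :: "('a \<Rightarrow>\<^sub>L 'a) \<Rightarrow> 'a set \<Rightarrow> bool" where
  "almost_invariant S Y \<longleftrightarrow>
     (\<exists>F. finite_dim_subspace F \<and> S ` Y \<subseteq> {y + f |y f. y \<in> Y \<and> f \<in> F})"

lemma bounded_linear_scl: "bounded_linear (scl c)"
proof (rule bounded_linear_intro [where K = "norm c"])
  fix r x
  show "scl c (r *\<^sub>R x) = r *\<^sub>R scl c x"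
    by (simp flip: scl_of_real add: mult.commute)
qed (simp_all add: scale_right_distrib norm_scl mult.commute)

lemma scale_op_apply [simp]: "scale_op c S x = scl c (S x)"
proof -
  have "bounded_linear (\<lambda>x. scl c (S x))"
    by (rule bounded_linear_compose [OF bounded_linear_scl blinfun.bounded_linear_right])
  then show ?thesis
    by (simp add: scale_op_def bounded_linear_Blinfun_apply)
qed

lemma subalgebra_operators: "subalgebra operators"
  by (auto simp: subalgebra_def operators_def blinfun.add_left scale_right_distrib mult.commute)

lemma closed_operators: "closed operators"
proof -
  have "closed {S :: 'a \<Rightarrow>\<^sub>L 'a. S (scl c x) = scl c (S x)}" for c x
    by (intro closed_Collect_eq continuous_intros
        bounded_linear.continuous_on [OF bounded_linear_scl])
  then show ?thesis
    by (auto simp: operators_def intro!: closed_Collect_all)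
qed

lemma closed_algebra_generated_by:
  assumes "G \<subseteq> operators"
  shows "subalgebra (closed_algebra_generated_by G)" "closed (closed_algebra_generated_by G)"
    "G \<subseteq> closed_algebra_generated_by G"
proof -
  show "subalgebra (closed_algebra_generated_by G)"
    using assms subalgebra_operators closed_operators
    unfolding closed_algebra_generated_by_def subalgebra_def by blast
qed (auto simp: closed_algebra_generated_by_def)

end

lemma banach_space_over_real:
  "banach_space_over (scaleR :: real \<Rightarrow> 'a::banach \<Rightarrow> 'a)"
  by unfold_locales (auto simp: algebra_simps)

lemma banach_space_over_complex:
  "banach_space_over ((*) :: complex \<Rightarrow> complex \<Rightarrow> complex)"
  by unfold_locales (auto simp: algebra_simps norm_mult scaleR_conv_of_real)

end

theory Submission
  imports Defs
begin

text \<open>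
  For \<open>S\<close> in the algebra \<open>A\<close>, almost invariance says that the induced map from \<open>Y\<close> to \<open>X / Y\<close> has finite
  rank. Having rank at most \<open>n\<close> is a closed condition, so by Baire the rank is bounded on a nonempty
  relatively open subset of \<open>A\<close>; choose \<open>S0\<close> there with maximal rank. A perturbation argument shows
  that every \<open>S\<close> in \<open>A\<close> maps \<open>W = {y \<in> Y. S0 y \<in> Y}\<close>, which has finite codimension in \<open>Y\<close>, into
  \<open>Y + F\<close> for a finite-dimensional \<open>F\<close> independent of \<open>S\<close>. Then \<open>W + A W\<close> is invariant and lies between
  \<open>W\<close> and a finite-dimensional extension of \<open>W\<close>, so it is a closed half-space.

  The linear algebra is done over the reals; this suffices because a \<open>real_normed_field\<close> is generated by
  two elements as a real vector space, a case of the Gelfand-Mazur theorem.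
\<close>

section \<open>Real normed fields\<close>

text \<open>
  For \<open>j = 0\<close>, the expression \<open>u\<^sup>2 - 2 * Re c * u + (cmod c)\<^sup>2\<close> is the product of the values at \<open>x\<close>
  of the real quadratics with roots \<open>s + w\<close>, \<open>s - w\<close> and their conjugates, where \<open>w\<^sup>2 = c - e\<close>.
  The expression for \<open>Suc j\<close> and \<open>d\<^sup>2\<close> is the product of the expressions for \<open>j\<close> at \<open>d\<close> and at \<open>- d\<close>, so no polynomial factorization is needed.
\<close>

lemma norm_quadratic_ge:
  fixes x :: "'k::real_normed_field" and s e m :: real
  assumes m: "\<And>a b. m \<le> norm ((x - of_real a)\<^sup>2 + of_real (b\<^sup>2))" and "0 \<le> m"
  defines "u \<equiv> (x - of_real s)\<^sup>2 + of_real e"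
  shows "m ^ 2 ^ Suc j \<le>
    norm (u ^ 2 ^ Suc j - of_real (2 * Re c) * u ^ 2 ^ j + of_real ((cmod c)\<^sup>2))"
proof (induction j arbitrary: c)
  case 0
  define w where "w = csqrt (c - of_real e)"
  define a b where "a = Re w" and "b = Im w"
  have w2: "w\<^sup>2 = c - of_real e"
    by (simp add: w_def)
  have 1: "a\<^sup>2 - b\<^sup>2 = Re c - e"
    using arg_cong [OF w2, of Re] by (simp add: a_def b_def power2_eq_square)
  have 2: "2 * a * b = Im c"
    using arg_cong [OF w2, of Im] by (simp add: a_def b_def power2_eq_square mult_ac)
  have "(Re c)\<^sup>2 + (Im c)\<^sup>2 = (a\<^sup>2 - b\<^sup>2 + e)\<^sup>2 + (2 * a * b)\<^sup>2"
    using 1 2 by simp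
  then have 3: "(cmod c)\<^sup>2 = (a\<^sup>2 - b\<^sup>2 + e)\<^sup>2 + (2 * a * b)\<^sup>2"
    by (simp add: cmod_power2)
  have 4: "Re c = a\<^sup>2 - b\<^sup>2 + e"
    using 1 by simp
  have "u\<^sup>2 - of_real (2 * Re c) * u + of_real ((cmod c)\<^sup>2)
      = ((x - of_real (s + a))\<^sup>2 + of_real (b\<^sup>2)) * ((x - of_real (s - a))\<^sup>2 + of_real (b\<^sup>2))"
    unfolding 3 4 u_def by (simp add: power2_eq_square algebra_simps)
  moreover have "m * m \<le> norm ((x - of_real (s + a))\<^sup>2 + of_real (b\<^sup>2))
      * norm ((x - of_real (s - a))\<^sup>2 + of_real (b\<^sup>2))"
    by (intro mult_mono m \<open>0 \<le> m\<close> norm_ge_zero)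
  ultimately show ?case
    by (simp add: norm_mult power2_eq_square)
next
  case (Suc j)
  define d where "d = csqrt c"
  define v where "v = u ^ 2 ^ j"
  let ?N = "\<lambda>c. v\<^sup>2 - of_real (2 * Re c) * v + of_real ((cmod c)\<^sup>2)"
  have c: "c = d\<^sup>2"
    by (simp add: d_def)
  have Re: "Re c = 2 * (Re d)\<^sup>2 - (cmod d)\<^sup>2"
    using cmod_power2 [of d] unfolding c by (simp add: power2_eq_square)
  have "cmod c = (cmod d)\<^sup>2"
    by (simp add: c norm_power)
  then have "(v\<^sup>2)\<^sup>2 - of_real (2 * Re c) * v\<^sup>2 + of_real ((cmod c)\<^sup>2) = ?N d * ?N (- d)"
    unfolding Re by (simp add: power2_eq_square algebra_simps)
  moreover have "m ^ 2 ^ Suc j * m ^ 2 ^ Suc j \<le> norm (?N d) * norm (?N (- d))"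
    using Suc.IH [of d] Suc.IH [of "- d"]
    by (intro mult_mono) (simp_all add: v_def power_mult \<open>0 \<le> m\<close> mult.commute flip: power_mult)
  ultimately show ?case
    by (simp add: v_def norm_mult mult.commute flip: power_mult power_add mult_2)
qed

text \<open>
  The factors of \<open>u ^ 2 ^ j - t ^ 2 ^ j\<close> other than \<open>u + t\<close> have norm at least the corresponding
  power of \<open>m\<close>, so \<open>norm (u + t) * m ^ (2 ^ j - 1) \<le> m ^ 2 ^ j + t ^ 2 ^ j\<close>; let \<open>j\<close> tend to infinity.
\<close>

lemma norm_minimal_shift:
  fixes x :: "'k::real_normed_field" and s e m :: real
  assumes m: "\<And>a b. m \<le> norm ((x - of_real a)\<^sup>2 + of_real (b\<^sup>2))" and "0 < m"
    and u: "norm ((x - of_real s)\<^sup>2 + of_real e) = m"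
  shows "norm ((x - of_real s)\<^sup>2 + of_real (e + m / 2)) \<le> m"
proof -
  define u where "u = (x - of_real s)\<^sup>2 + of_real e"
  define t where "t = m / 2"
  have t: "0 < t"
    using \<open>0 < m\<close> by (simp add: t_def)
  \<comment> \<open>For real \<open>c = r\<close> the quadratic of \<open>norm_quadratic_ge\<close>
    is the square of \<open>u ^ 2 ^ j - of_real r\<close>, so a square root can be taken.\<close>
  have sq: "m ^ 2 ^ j \<le> norm (u ^ 2 ^ j - of_real r)" for j and r :: real
  proof -
    have "m ^ 2 ^ Suc j \<le> norm (u ^ 2 ^ Suc j - of_real (2 * r) * u ^ 2 ^ j + of_real (r\<^sup>2))"
      using norm_quadratic_ge [where x = x and m = m and s = s and e = e and j = j
          and c = "of_real r"] m \<open>0 < m\<close> by (simp add: u_def)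
    also have "u ^ 2 ^ Suc j - of_real (2 * r) * u ^ 2 ^ j + of_real (r\<^sup>2) = (u ^ 2 ^ j - of_real r)\<^sup>2"
      by (simp add: power2_diff mult.commute flip: power_mult)
    finally have "(m ^ 2 ^ j)\<^sup>2 \<le> (norm (u ^ 2 ^ j - of_real r))\<^sup>2"
      by (simp add: norm_power mult.commute flip: power_mult)
    then show ?thesis
      by (rule power2_le_imp_le) simp
  qed
  \<comment> \<open>\<open>u + t\<close> is a factor of \<open>u ^ 2 ^ j - t ^ 2 ^ j\<close> only
    from \<open>j = 1\<close> on. At \<open>j = 1\<close> the cofactor \<open>u - t\<close> has norm
    at least \<open>m\<close>; each doubling brings in \<open>u ^ 2 ^ j + t ^ 2 ^ j\<close>, bounded
    below by \<open>sq\<close> with \<open>r = - (t ^ 2 ^ j)\<close>.\<close>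
  have prod: "norm (u + of_real t) * m ^ 2 ^ j \<le> m * norm (u ^ 2 ^ j - of_real (t ^ 2 ^ j))"
    if "0 < j" for j
    using that
  proof (induction j rule: nat_induct_non_zero)
    case 1
    have "norm (u + of_real t) * m * m \<le> norm (u + of_real t) * norm (u - of_real t) * m"
      using sq [of 0 t] \<open>0 < m\<close> by (intro mult_right_mono mult_left_mono) auto
    also have "norm (u + of_real t) * norm (u - of_real t) = norm (u\<^sup>2 - of_real (t\<^sup>2))"
      by (simp add: power2_eq_square algebra_simps flip: norm_mult)
    finally show ?case
      by (simp add: power2_eq_square mult_ac)
  next
    case (Suc j)
    have *: "a\<^sup>2 - b\<^sup>2 = (a - b) * (a + b)" for a b :: 'k
      by (simp add: power2_eq_square algebra_simps)
    have "norm (u + of_real t) * m ^ 2 ^ Suc j = norm (u + of_real t) * m ^ 2 ^ j * m ^ 2 ^ j"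
      by (simp add: mult_2 power_add)
    also have "\<dots> \<le> m * norm (u ^ 2 ^ j - of_real (t ^ 2 ^ j))
        * norm (u ^ 2 ^ j - of_real (- (t ^ 2 ^ j)))"
      using \<open>0 < m\<close> by (intro mult_mono Suc.IH sq) auto
    also have "\<dots> = m * norm (u ^ 2 ^ Suc j - of_real (t ^ 2 ^ Suc j))"
      using * [of "u ^ 2 ^ j" "of_real t ^ 2 ^ j"]
      by (simp add: norm_mult mult.commute flip: power_mult)
    finally show ?case .
  qed
  have bound: "norm (u + of_real t) \<le> m * (1 + (1/2) ^ 2 ^ j)" if "0 < j" for j
  proof -
    have "norm (u ^ 2 ^ j - of_real (t ^ 2 ^ j)) \<le> m ^ 2 ^ j + t ^ 2 ^ j"
      using norm_triangle_ineq4 [of "u ^ 2 ^ j" "of_real (t ^ 2 ^ j)"] u t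
      by (simp add: u_def norm_power)
    also have "\<dots> = (1 + (1/2) ^ 2 ^ j) * m ^ 2 ^ j"
      by (simp add: t_def power_divide algebra_simps)
    finally have "norm (u + of_real t) * m ^ 2 ^ j \<le> m * ((1 + (1/2) ^ 2 ^ j) * m ^ 2 ^ j)"
      using prod [OF that] \<open>0 < m\<close> by (meson mult_left_mono order_trans less_imp_le)
    then show ?thesis
      using \<open>0 < m\<close> by (simp flip: mult.assoc)
  qed
  have "(\<lambda>j. m * (1 + (1/2) ^ 2 ^ j)) \<longlonglongrightarrow> m * (1 + 0)"
  proof (intro tendsto_intros)
    have "strict_mono (\<lambda>j. 2 ^ j :: nat)"
      by (simp add: strict_monoI)
    from LIMSEQ_subseq_LIMSEQ [OF LIMSEQ_realpow_zero this, of "1/2"]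
    show "(\<lambda>j. (1/2 :: real) ^ 2 ^ j) \<longlonglongrightarrow> 0"
      by (simp add: o_def)
  qed
  then have "norm (u + of_real t) \<le> m * (1 + 0)"
    by (rule LIMSEQ_le_const) (use bound in \<open>auto intro!: exI [of _ 1]\<close>)
  then show ?thesis
    by (simp add: u_def t_def add.assoc)
qed

text \<open>The function \<open>f\<close> attains a minimum because it is large far from the origin.
  Were the minimum positive, \<open>norm_minimal_shift\<close> could be iterated: adding arbitrarily
  large real constants would leave the norm unchanged, against the triangle inequality.\<close>

lemma real_normed_field_quadratic:
  fixes x :: "'k::real_normed_field"
  shows "\<exists>a b. (x - of_real a)\<^sup>2 = - of_real (b\<^sup>2)"
proof -
  define f where "f = (\<lambda>z. norm ((x - of_real (Re z))\<^sup>2 + of_real ((Im z)\<^sup>2)))"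
  \<comment> \<open>Outside this ball \<open>norm w > 3 * norm x\<close>, so \<open>f w\<close> is
    at least \<open>(norm w - norm x)^2 - 2 * (norm x)^2\<close>, hence at least
    \<open>2 * (norm x)^2\<close>, which is no less than \<open>f 0\<close>.\<close>
  define R where "R = 3 * norm x + 1"
  have f0: "f 0 = (norm x)\<^sup>2"
    by (simp add: f_def norm_power)
  have "continuous_on (cball 0 R) f"
    unfolding f_def by (intro continuous_intros)
  then have "\<exists>z\<in>cball 0 R. \<forall>w\<in>cball 0 R. f z \<le> f w"
    by (intro continuous_attains_inf) (auto simp: R_def not_less intro: add_nonneg_nonneg)
  then obtain z where z: "\<And>w. w \<in> cball 0 R \<Longrightarrow> f z \<le> f w"
    by blast
  have min: "f z \<le> f w" for w
  proof (cases "norm w \<le> R")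
    case True
    then show ?thesis
      using z by simp
  next
    case False
    have "(x - of_real (Re w))\<^sup>2 + of_real ((Im w)\<^sup>2)
        = of_real ((norm w)\<^sup>2) - (of_real (2 * Re w) * x - x\<^sup>2)"
      unfolding cmod_power2 by (simp add: power2_eq_square algebra_simps)
    then have fw: "f w = norm (of_real ((norm w)\<^sup>2) - (of_real (2 * Re w) * x - x\<^sup>2))"
      unfolding f_def by (rule arg_cong)
    have "norm (of_real (2 * Re w) * x - x\<^sup>2) \<le> 2 * \<bar>Re w\<bar> * norm x + (norm x)\<^sup>2"
      using norm_triangle_ineq4 [of "of_real (2 * Re w) * x" "x\<^sup>2"]
      by (simp add: norm_mult norm_power)
    also have "2 * \<bar>Re w\<bar> * norm x \<le> 2 * norm w * norm x"
      by (intro mult_right_mono) (auto simp: abs_Re_le_cmod)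
    finally have "(norm w)\<^sup>2 - (2 * norm w * norm x + (norm x)\<^sup>2) \<le> f w"
      unfolding fw
      using norm_triangle_ineq2 [of "of_real ((norm w)\<^sup>2)" "of_real (2 * Re w) * x - x\<^sup>2"]
      by (simp add: norm_power)
    moreover have "(2 * norm x)\<^sup>2 \<le> (norm w - norm x)\<^sup>2"
      using False by (intro power_mono) (auto simp: R_def)
    moreover have "(2 * norm x)\<^sup>2 = 4 * (norm x)\<^sup>2" "0 \<le> (norm x)\<^sup>2"
      by (simp_all add: power_mult_distrib)
    ultimately have "f 0 \<le> f w"
      unfolding f0 power2_diff by linarith
    moreover have "f z \<le> f 0"
      using z by (simp add: R_def)
    ultimately show ?thesis
      by simp
  qed
  have "f z = 0"
  proof (rule ccontr)
    assume "f z \<noteq> 0"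
    define m where "m = f z"
    define y where "y = (x - of_real (Re z))\<^sup>2"
    have "0 < m"
      using \<open>f z \<noteq> 0\<close> by (simp add: m_def f_def)
    have m: "m \<le> norm ((x - of_real a)\<^sup>2 + of_real (b\<^sup>2))" for a b
      using min [of "Complex a b"] by (simp add: m_def f_def)
    \<comment> \<open>The shifted constant is nonnegative, hence of the form \<open>b^2\<close>, so
      minimality gives the bound opposite to \<open>norm_minimal_shift\<close>. The norm is again
      exactly \<open>m\<close>, as the next shift requires.\<close>
    have "norm (y + of_real ((Im z)\<^sup>2 + real k * (m / 2))) = m" for k
    proof (induction k)
      case 0
      show ?case
        by (simp add: m_def f_def y_def)
    next
      case (Suc k)
      have "norm (y + of_real ((Im z)\<^sup>2 + real k * (m / 2) + m / 2)) \<le> m"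
        using norm_minimal_shift [OF m \<open>0 < m\<close>] Suc.IH unfolding y_def by blast
      moreover have "(Im z)\<^sup>2 + real k * (m / 2) + m / 2 = (sqrt ((Im z)\<^sup>2 + real (Suc k) * (m / 2)))\<^sup>2"
        using \<open>0 < m\<close> by (simp add: algebra_simps add_divide_distrib)
      ultimately show ?case
        using m [of "Re z" "sqrt ((Im z)\<^sup>2 + real (Suc k) * (m / 2))"]
        by (simp add: y_def algebra_simps add_divide_distrib)
    qed
    then have "(Im z)\<^sup>2 + real k * (m / 2) \<le> m + norm y" for k
      using norm_triangle_ineq4 [of "y + of_real ((Im z)\<^sup>2 + real k * (m / 2))" y] \<open>0 < m\<close>
      by (smt (verit) add_diff_cancel_left' norm_of_real)
    moreover obtain k where "m + norm y < real k * (m / 2)"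
      using reals_Archimedean3 [of "m / 2"] \<open>0 < m\<close> by (auto simp del: times_divide_eq_right)
    ultimately show False
      by (smt (verit) zero_le_power2)
  qed
  then show ?thesis
    unfolding f_def norm_eq_zero eq_neg_iff_add_eq_0 by blast
qed

text \<open>If some \<open>x\<close> is not real, its quadratic relation yields \<open>e\<close>
  with square \<open>- 1\<close>. The relation for any \<open>c\<close> then reads
  \<open>(c - a)^2 = (b * e)^2\<close>, and in a field this forces \<open>c - a\<close> to be
  \<open>b * e\<close> or its negative.\<close>

lemma real_normed_field_two_generators:
  obtains e :: "'k::real_normed_field" where "\<And>c. \<exists>a b. c = of_real a + of_real b * e"
proof (cases "\<forall>c::'k. c \<in> \<real>")
  case True
  then have "\<exists>a b. c = of_real a + of_real b * 0" for c :: 'k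
    by (metis Reals_cases add.right_neutral mult_zero_right)
  then show ?thesis
    by (rule that)
next
  case False
  then obtain x :: 'k where x: "x \<notin> \<real>"
    by blast
  obtain a b where ab: "(x - of_real a)\<^sup>2 = - of_real (b\<^sup>2)"
    using real_normed_field_quadratic by blast
  have "b \<noteq> 0"
    using ab x by auto
  define e where "e = (x - of_real a) / of_real b"
  have e: "e\<^sup>2 = - 1"
    using ab \<open>b \<noteq> 0\<close> by (simp add: e_def power_divide)
  have "\<exists>a b. c = of_real a + of_real b * e" for c :: 'k
  proof -
    obtain a b where "(c - of_real a)\<^sup>2 = - of_real (b\<^sup>2)"
      using real_normed_field_quadratic by blast
    also have "\<dots> = (of_real b * e)\<^sup>2"
      using e by (simp add: power_mult_distrib)
    finally have "c - of_real a = of_real b * e \<or> c - of_real a = - (of_real b * e)"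
      by (simp only: power2_eq_iff)
    then have "c = of_real a + of_real b * e \<or> c = of_real a + of_real (- b) * e"
      by (auto simp: diff_eq_eq add.commute)
    then show ?thesis
      by blast
  qed
  then show ?thesis
    by (rule that)
qed

section \<open>Independence modulo a closed subspace\<close>

text \<open>Here \<open>d\<close> is the radius of a ball around \<open>v\<close> that misses
  \<open>W\<close>; dividing by \<open>- c\<close> reduces to the case of
  \<open>w - v\<close>.\<close>

lemma dist_subspace_bound:
  fixes W :: "'a::real_normed_vector set"
  assumes "closed W" "subspace W" "v \<notin> W"
  obtains d where "0 < d" "\<And>w c. w \<in> W \<Longrightarrow> d * \<bar>c\<bar> \<le> norm (w + c *\<^sub>R v)"
proof -
  obtain d where "0 < d" and d: "\<And>w. dist w v < d \<Longrightarrow> w \<notin> W"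
    using assms(1,3) unfolding closed_def open_dist by auto
  have "d * \<bar>c\<bar> \<le> norm (w + c *\<^sub>R v)" if "w \<in> W" for w c
  proof (cases "c = 0")
    case False
    have "(- (1 / c)) *\<^sub>R w \<in> W"
      using assms(2) that by (rule subspace_scale)
    then have "d \<le> norm ((- (1 / c)) *\<^sub>R w - v)"
      using d unfolding dist_norm by force
    also have "(- (1 / c)) *\<^sub>R w - v = (- (1 / c)) *\<^sub>R (w + c *\<^sub>R v)"
      using False by (simp add: scaleR_add_right)
    finally have "d \<le> norm (w + c *\<^sub>R v) / \<bar>c\<bar>"
      by simp
    then show ?thesis
      using False by (simp add: field_simps)
  qed simp
  with \<open>0 < d\<close> show thesis
    by (rule that)
qed

text \<open>By the distance bound the coefficient of \<open>v\<close> is a Lipschitz function. Along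
  a convergent sequence the coefficients therefore converge, and the remainders converge inside the
  closed \<open>span W\<close>.\<close>

lemma closed_span_insert:
  fixes W :: "'a::real_normed_vector set"
  assumes "closed (span W)"
  shows "closed (span (insert v W))"
proof (cases "v \<in> span W")
  case True
  then show ?thesis
    using assms by (simp add: span_redundant)
next
  case False
  obtain d where "0 < d" and d: "\<And>w c. w \<in> span W \<Longrightarrow> d * \<bar>c\<bar> \<le> norm (w + c *\<^sub>R v)"
    using dist_subspace_bound [OF assms subspace_span False] by blast
  show ?thesis
    unfolding closed_sequential_limits
  proof (intro allI impI, elim conjE)
    fix x l
    assume "\<forall>n. x n \<in> span (insert v W)" and lim: "x \<longlonglongrightarrow> l"
    then have "\<forall>n. \<exists>c. x n - c *\<^sub>R v \<in> span W"
      by (simp add: span_insert)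
    then obtain c where c: "\<And>n. x n - c n *\<^sub>R v \<in> span W"
      by metis
    have "d * \<bar>c m - c n\<bar> \<le> norm (x m - x n)" for m n
      using d [OF span_diff [OF c [of m] c [of n]], of "c m - c n"]
      by (simp add: algebra_simps)
    then have cauchy: "\<bar>c m - c n\<bar> \<le> dist (x m) (x n) / d" for m n
      using \<open>0 < d\<close> by (simp add: field_simps dist_norm)
    have "Cauchy c"
    proof (rule metric_CauchyI)
      fix e :: real
      assume "0 < e"
      then obtain N where "\<forall>m\<ge>N. \<forall>n\<ge>N. dist (x m) (x n) < e * d"
        using LIMSEQ_imp_Cauchy [OF lim] \<open>0 < d\<close> by (meson metric_CauchyD mult_pos_pos)
      then show "\<exists>N. \<forall>m\<ge>N. \<forall>n\<ge>N. dist (c m) (c n) < e"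
        using cauchy \<open>0 < d\<close> unfolding dist_real_def
        by (metis le_less_trans pos_divide_less_eq)
    qed
    then obtain b where "c \<longlonglongrightarrow> b"
      by (auto simp: Cauchy_convergent_iff convergent_def)
    then have "(\<lambda>n. x n - c n *\<^sub>R v) \<longlonglongrightarrow> l - b *\<^sub>R v"
      by (intro tendsto_intros lim)
    then have "l - b *\<^sub>R v \<in> span W"
      by (rule closed_sequentially [OF assms c])
    then show "l \<in> span (insert v W)"
      by (auto simp: span_insert)
  qed
qed

lemma closed_span_Un_finite:
  fixes Y :: "'a::real_normed_vector set"
  assumes "closed Y" "subspace Y" "finite B"
  shows "closed (span (Y \<union> B))"
  using assms(3)
proof (induction B)
  case empty
  then show ?case
    using assms by (simp add: span_eq_iff [THEN iffD2])
next
  case (insert b B)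
  then show ?case
    using closed_span_insert [of "Y \<union> B" b] by simp
qed

text \<open>Modular law: if \<open>z = w + b\<close>, then \<open>b = z - w\<close> lies in
  \<open>Z\<close> as well. So \<open>Z\<close> is the sum of \<open>W\<close> and the
  finite-dimensional space of vectors common to \<open>Z\<close> and \<open>span B\<close>.\<close>

lemma closed_finite_extension:
  fixes W :: "'a::real_normed_vector set"
  assumes "closed W" "subspace W" "subspace Z" "W \<subseteq> Z" "finite B" "Z \<subseteq> span (W \<union> B)"
  shows "closed Z"
proof -
  obtain C where C: "C \<subseteq> Z \<inter> span B" "independent C" "Z \<inter> span B \<subseteq> span C"
    using real_vector.maximal_independent_subset by blast
  have "finite C"
    using independent_span_bound [OF \<open>finite B\<close>] C by auto
  have "Z = span (W \<union> C)"
  proof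
    show "span (W \<union> C) \<subseteq> Z"
      using assms C by (intro span_minimal) auto
    show "Z \<subseteq> span (W \<union> C)"
    proof
      fix z
      assume "z \<in> Z"
      then obtain w b where wb: "z = w + b" "w \<in> W" "b \<in> span B"
        using assms(2,6) by (auto simp: span_Un span_eq_iff [THEN iffD2])
      then have "b \<in> Z"
        using subspace_diff [OF assms(3) \<open>z \<in> Z\<close>, of w] assms(4) by auto
      then have "b \<in> span C"
        using C wb by blast
      then show "z \<in> span (W \<union> C)"
        using wb by (auto simp: span_Un intro: span_base)
    qed
  qed
  then show ?thesis
    using closed_span_Un_finite [OF assms(1,2) \<open>finite C\<close>] by simp
qed

section \<open>Linear independence in the quotient and its stability\<close>

text \<open>Linear independence of the cosets of \<open>v 0\<close>, ..., \<open>v (r - 1)\<close>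
  in the quotient by \<open>Y\<close>. An indexed family allows limits to be taken entry by
  entry.\<close>

definition independent_mod :: "'a::real_vector set \<Rightarrow> nat \<Rightarrow> (nat \<Rightarrow> 'a) \<Rightarrow> bool" where
  "independent_mod Y r v \<longleftrightarrow> (\<forall>c. (\<Sum>i<r. c i *\<^sub>R v i) \<in> Y \<longrightarrow> (\<forall>i<r. c i = 0))"

lemma independent_mod_cong:
  assumes "subspace Y" "\<And>i. i < r \<Longrightarrow> v i - w i \<in> Y"
  shows "independent_mod Y r v \<longleftrightarrow> independent_mod Y r w"
proof -
  have "(\<Sum>i<r. c i *\<^sub>R v i) \<in> Y \<longleftrightarrow> (\<Sum>i<r. c i *\<^sub>R w i) \<in> Y" for c
  proof -
    have "(\<Sum>i<r. c i *\<^sub>R v i) - (\<Sum>i<r. c i *\<^sub>R w i) \<in> Y"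
      using assms by (auto simp flip: sum_subtractf scaleR_diff_right
          intro!: subspace_sum subspace_scale)
    from subspace_diff [OF assms(1) _ this, of "\<Sum>i<r. c i *\<^sub>R v i"]
      subspace_add [OF assms(1) _ this, of "\<Sum>i<r. c i *\<^sub>R w i"]
    show ?thesis
      by auto
  qed
  then show ?thesis
    by (simp add: independent_mod_def)
qed

lemma independent_mod_Suc:
  assumes "subspace Y"
  shows "independent_mod Y (Suc r) v \<longleftrightarrow> independent_mod Y r v \<and> v r \<notin> span (Y \<union> v ` {..<r})"
proof -
  have 1: "\<exists>c. x - (\<Sum>i<r. c i *\<^sub>R v i) \<in> Y" if "x \<in> span (Y \<union> v ` {..<r})" for x
    using that
  proof (induction r arbitrary: x)
    case 0
    then show ?case
      using assms by (simp add: span_eq_iff [THEN iffD2])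
  next
    case (Suc r)
    then obtain k where "x - k *\<^sub>R v r \<in> span (Y \<union> v ` {..<r})"
      by (auto simp: lessThan_Suc span_insert)
    then obtain c where "x - k *\<^sub>R v r - (\<Sum>i<r. c i *\<^sub>R v i) \<in> Y"
      using Suc.IH by blast
    then have "x - (\<Sum>i<Suc r. (c(r := k)) i *\<^sub>R v i) \<in> Y"
      by (simp add: algebra_simps)
    then show ?case
      by blast
  qed
  have 2: "x \<in> span (Y \<union> v ` {..<r})" if "x + (\<Sum>i<r. c i *\<^sub>R v i) \<in> Y" for x c
  proof -
    have "(\<Sum>i<r. c i *\<^sub>R v i) \<in> span (Y \<union> v ` {..<r})"
      by (intro span_sum span_scale span_base) auto
    then have "x + (\<Sum>i<r. c i *\<^sub>R v i) - (\<Sum>i<r. c i *\<^sub>R v i) \<in> span (Y \<union> v ` {..<r})"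
      using that by (intro span_diff) (auto intro: span_base)
    then show ?thesis
      by simp
  qed
  show ?thesis
  proof
    assume R: "independent_mod Y (Suc r) v"
    have "c i = 0" if "(\<Sum>i<r. c i *\<^sub>R v i) \<in> Y" "i < r" for c i
      using R [unfolded independent_mod_def, rule_format, of "c(r := 0)" i] that by simp
    then have "independent_mod Y r v"
      by (simp add: independent_mod_def)
    moreover have False if "v r \<in> span (Y \<union> v ` {..<r})"
    proof -
      obtain c where "v r - (\<Sum>i<r. c i *\<^sub>R v i) \<in> Y"
        using 1 [OF \<open>v r \<in> span (Y \<union> v ` {..<r})\<close>] by blast
      then show False
        using R [unfolded independent_mod_def, rule_format, of "(\<lambda>i. - c i)(r := 1)" r]
        by (simp add: sum_negf)
    qed
    ultimately show "independent_mod Y r v \<and> v r \<notin> span (Y \<union> v ` {..<r})"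
      by blast
  next
    assume R: "independent_mod Y r v \<and> v r \<notin> span (Y \<union> v ` {..<r})"
    have "\<forall>i<Suc r. c i = 0" if c: "(\<Sum>i<Suc r. c i *\<^sub>R v i) \<in> Y" for c
    proof -
      have "c r *\<^sub>R v r \<in> span (Y \<union> v ` {..<r})"
        using c by (intro 2 [of _ c]) (simp add: add.commute)
      then have "c r = 0"
        using R span_scale [of "c r *\<^sub>R v r" "Y \<union> v ` {..<r}" "1 / c r"]
        by (auto split: if_splits)
      then show ?thesis
        using R c by (auto simp: independent_mod_def less_Suc_eq)
    qed
    then show "independent_mod Y (Suc r) v"
      by (simp add: independent_mod_def)
  qed
qed

lemma independent_mod_extend:
  assumes "subspace Y" "independent_mod Y r v" "x \<notin> span (Y \<union> v ` {..<r})"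
  shows "independent_mod Y (Suc r) (v(r := x))"
proof -
  have "(v(r := x)) ` {..<r} = v ` {..<r}"
    by auto
  moreover have "independent_mod Y r (v(r := x))"
    using assms(2) independent_mod_cong [OF assms(1), of r v "v(r := x)"] subspace_0 [OF assms(1)]
    by simp
  ultimately show ?thesis
    using assms(3) by (simp add: independent_mod_Suc [OF assms(1)])
qed

text \<open>Uniform in \<open>y\<close>, this is the quantitative form of independence that survives
  perturbation. The induction peels off the last vector, whose coefficient is controlled by its
  distance to the closed span \<open>W\<close> of the others and \<open>Y\<close>.\<close>

lemma independent_mod_lower_bound:
  fixes Y :: "'a::real_normed_vector set"
  assumes "closed Y" "subspace Y" "independent_mod Y r v"
  shows "\<exists>d>0. \<forall>y\<in>Y. \<forall>c. d * (\<Sum>i<r. \<bar>c i\<bar>) \<le> norm (y + (\<Sum>i<r. c i *\<^sub>R v i))"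
  using assms(3)
proof (induction r)
  case 0
  show ?case
    by (auto intro: exI [of _ 1])
next
  case (Suc r)
  define W where "W = span (Y \<union> v ` {..<r})"
  have r: "independent_mod Y r v" "v r \<notin> W"
    using Suc.prems independent_mod_Suc [OF assms(2)] by (auto simp: W_def)
  obtain d where "0 < d"
    and d: "\<And>y c. y \<in> Y \<Longrightarrow> d * (\<Sum>i<r. \<bar>c i\<bar>) \<le> norm (y + (\<Sum>i<r. c i *\<^sub>R v i))"
    using Suc.IH [OF r(1)] by blast
  have "closed W" "subspace W"
    using closed_span_Un_finite [OF assms(1,2)] by (auto simp: W_def)
  then obtain e where "0 < e" and e: "\<And>w c. w \<in> W \<Longrightarrow> e * \<bar>c\<bar> \<le> norm (w + c *\<^sub>R v r)"
    using dist_subspace_bound r(2) by blast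
  \<comment> \<open>The last coefficient is at most \<open>N / e\<close>, so \<open>norm w\<close>
    is at most \<open>N + N / e * norm (v r)\<close>; dividing by \<open>d\<close> bounds the other
    coefficients. \<open>M\<close> adds up both estimates.\<close>
  define M where "M = (1 + norm (v r) / e) / d + 1 / e"
  have "0 < M"
    using \<open>0 < d\<close> \<open>0 < e\<close> by (simp add: M_def add_pos_nonneg add_nonneg_pos)
  have "(\<Sum>i<Suc r. \<bar>c i\<bar>) \<le> M * norm (y + (\<Sum>i<Suc r. c i *\<^sub>R v i))" if "y \<in> Y" for y c
  proof -
    define w where "w = y + (\<Sum>i<r. c i *\<^sub>R v i)"
    define N where "N = norm (w + c r *\<^sub>R v r)"
    have "w \<in> W"
      unfolding w_def W_def using that
      by (intro span_add span_sum span_scale span_base) auto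
    then have c: "\<bar>c r\<bar> \<le> N / e"
      using e [of w "c r"] \<open>0 < e\<close> by (simp add: N_def field_simps)
    have "d * (\<Sum>i<r. \<bar>c i\<bar>) \<le> norm w"
      using d that by (simp add: w_def)
    also have "norm w \<le> N + \<bar>c r\<bar> * norm (v r)"
      using norm_triangle_ineq4 [of "w + c r *\<^sub>R v r" "c r *\<^sub>R v r"] by (simp add: N_def)
    also have "\<dots> \<le> N + N / e * norm (v r)"
      using mult_right_mono [OF c norm_ge_zero [of "v r"]] by simp
    finally have "(\<Sum>i<r. \<bar>c i\<bar>) \<le> (N + N / e * norm (v r)) / d"
      using \<open>0 < d\<close> by (simp add: field_simps)
    then have "(\<Sum>i<Suc r. \<bar>c i\<bar>) \<le> (N + N / e * norm (v r)) / d + N / e"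
      using c by simp
    also have "\<dots> = M * N"
      by (simp add: M_def algebra_simps add_divide_distrib)
    finally show ?thesis
      by (simp add: N_def w_def add.assoc)
  qed
  then show ?case
    using \<open>0 < M\<close> by (intro exI [of _ "1 / M"]) (simp add: field_simps)
qed

text \<open>Moving every \<open>v i\<close> by less than \<open>d\<close> changes a nontrivial
  combination by less than \<open>d\<close> times the sum of its absolute coefficients, too little
  to bring it into \<open>Y\<close>.\<close>

lemma eventually_independent_mod:
  fixes Y :: "'a::real_normed_vector set"
  assumes "closed Y" "subspace Y" "independent_mod Y r v"
    and lim: "\<And>i. i < r \<Longrightarrow> ((\<lambda>t. f t i) \<longlongrightarrow> v i) F"
  shows "eventually (\<lambda>t. independent_mod Y r (f t)) F"
proof -
  obtain d where "0 < d"
    and d: "\<And>y c. y \<in> Y \<Longrightarrow> d * (\<Sum>i<r. \<bar>c i\<bar>) \<le> norm (y + (\<Sum>i<r. c i *\<^sub>R v i))"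
    using independent_mod_lower_bound [OF assms(1-3)] by blast
  have "eventually (\<lambda>t. \<forall>i\<in>{..<r}. dist (f t i) (v i) < d) F"
    using tendstoD [OF lim \<open>0 < d\<close>] by (intro eventually_ball_finite) auto
  then show ?thesis
  proof (rule eventually_mono)
    fix t
    assume close: "\<forall>i\<in>{..<r}. dist (f t i) (v i) < d"
    show "independent_mod Y r (f t)"
      unfolding independent_mod_def
    proof (intro allI impI, rule ccontr)
      fix c j
      assume c: "(\<Sum>i<r. c i *\<^sub>R f t i) \<in> Y" and j: "j < r" "c j \<noteq> 0"
      have "d * (\<Sum>i<r. \<bar>c i\<bar>) \<le> norm (- (\<Sum>i<r. c i *\<^sub>R f t i) + (\<Sum>i<r. c i *\<^sub>R v i))"
        using c assms(2) by (intro d) (rule subspace_neg)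
      also have "\<dots> = norm (\<Sum>i<r. c i *\<^sub>R (v i - f t i))"
        by (simp add: scaleR_diff_right sum_subtractf)
      also have "\<dots> \<le> (\<Sum>i<r. \<bar>c i\<bar> * dist (f t i) (v i))"
        by (rule order_trans [OF norm_sum]) (simp add: dist_norm norm_minus_commute)
      also have "\<dots> < (\<Sum>i<r. \<bar>c i\<bar> * d)"
      proof (rule sum_strict_mono_ex1)
        show "\<forall>i\<in>{..<r}. \<bar>c i\<bar> * dist (f t i) (v i) \<le> \<bar>c i\<bar> * d"
          using close by (simp add: less_imp_le mult_left_mono)
        show "\<exists>i\<in>{..<r}. \<bar>c i\<bar> * dist (f t i) (v i) < \<bar>c i\<bar> * d"
          using close j by (intro bexI [of _ j]) auto
      qed simp
      finally show False
        by (simp add: sum_distrib_left mult.commute)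
    qed
  qed
qed

text \<open>Representatives of the \<open>v i\<close> modulo \<open>Y\<close> can be chosen in
  \<open>span B\<close>, where they are independent in the ordinary sense.\<close>

lemma independent_mod_card_le:
  assumes "subspace Y" "finite B" "independent_mod Y r v"
    and "\<And>i. i < r \<Longrightarrow> v i \<in> span (Y \<union> B)"
  shows "r \<le> card B"
proof -
  have "\<forall>i\<in>{..<r}. \<exists>b. v i - b \<in> Y \<and> b \<in> span B"
    using assms(1,4) by (force simp: span_Un span_eq_iff [THEN iffD2])
  then obtain b where b: "\<And>i. i < r \<Longrightarrow> v i - b i \<in> Y" "\<And>i. i < r \<Longrightarrow> b i \<in> span B"
    by (metis lessThan_iff)
  then have "independent_mod Y r b"
    using independent_mod_cong assms(1,3) by blast
  then have 0: "c i = 0" if "(\<Sum>i<r. c i *\<^sub>R b i) = 0" "i < r" for c i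
    using that subspace_0 [OF assms(1)] by (simp add: independent_mod_def)
  have inj: "inj_on b {..<r}"
  proof (rule inj_onI, rule ccontr)
    fix i j
    assume ij: "i \<in> {..<r}" "j \<in> {..<r}" "b i = b j" "i \<noteq> j"
    \<comment> \<open>A repeated vector would satisfy the nontrivial relation
      \<open>b i - b j = 0\<close>.\<close>
    define c :: "nat \<Rightarrow> real" where "c = (\<lambda>k. if k = i then 1 else if k = j then - 1 else 0)"
    have "(\<Sum>k<r. c k *\<^sub>R b k) = (\<Sum>k\<in>{i, j}. c k *\<^sub>R b k)"
      using ij by (intro sum.mono_neutral_right) (auto simp: c_def)
    also have "\<dots> = 0"
      using ij by (simp add: c_def)
    finally show False
      using 0 [of c i] ij by (simp add: c_def)
  qed
  have "independent (b ` {..<r})"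
    using 0 by (intro independent_if_scalars_zero) (auto simp: sum.reindex [OF inj])
  then have "card (b ` {..<r}) \<le> card B"
    using independent_span_bound assms(2) b(2) by (metis image_subsetI lessThan_iff)
  then show ?thesis
    by (simp add: card_image [OF inj])
qed

section \<open>A common finite-dimensional error\<close>

text \<open>Rank at least \<open>r\<close>, for the map induced by \<open>S\<close> from
  \<open>Y\<close> to the quotient, is an open condition: the vectors \<open>y i\<close> that
  witness it for \<open>R\<close> also do so for all nearby operators.\<close>

lemma open_independent_mod:
  fixes Y :: "'a::real_normed_vector set"
  assumes "closed Y" "subspace Y"
  shows "open {S :: 'a \<Rightarrow>\<^sub>L 'a. \<exists>y. (\<forall>i<r. y i \<in> Y) \<and> independent_mod Y r (\<lambda>i. S (y i))}"
    (is "open ?U")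
proof (subst open_subopen, intro ballI)
  fix R
  assume "R \<in> ?U"
  then obtain y where y: "\<forall>i<r. y i \<in> Y" "independent_mod Y r (\<lambda>i. R (y i))"
    by blast
  have "\<forall>\<^sub>F S in nhds R. independent_mod Y r (\<lambda>i. blinfun_apply S (y i))"
    by (rule eventually_independent_mod [OF assms y(2)]) (intro tendsto_intros filterlim_ident)
  then obtain V where "open V" "R \<in> V" "\<And>S. S \<in> V \<Longrightarrow> independent_mod Y r (\<lambda>i. S (y i))"
    by (auto simp: eventually_nhds)
  with y(1) show "\<exists>V. open V \<and> R \<in> V \<and> V \<subseteq> ?U"
    by blast
qed

lemma locally_bounded_rank:
  fixes A :: "('a::banach \<Rightarrow>\<^sub>L 'a) set"
  assumes "closed A" "A \<noteq> {}" "closed Y" "subspace Y"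
    and fin: "\<And>S. S \<in> A \<Longrightarrow> \<exists>B. finite B \<and> S ` Y \<subseteq> span (Y \<union> B)"
  obtains V n where "open V" "V \<inter> A \<noteq> {}"
    "\<And>S r y. \<lbrakk>S \<in> V \<inter> A; \<forall>i<r. y i \<in> Y; independent_mod Y r (\<lambda>i. S (y i))\<rbrakk> \<Longrightarrow> r \<le> n"
proof -
  define P where "P = (\<lambda>r (S :: 'a \<Rightarrow>\<^sub>L 'a). \<exists>y. (\<forall>i<r. y i \<in> Y) \<and> independent_mod Y r (\<lambda>i. S (y i)))"
  define Q where "Q = (\<lambda>r. {S \<in> A. \<not> P r S})"
  let ?X = "subtopology euclidean A"
  have Q: "closedin ?X (Q r)" for r
  proof -
    have "closed {S. \<not> P r S}"
      using open_independent_mod [OF assms(3,4), of r] by (simp add: P_def closed_def Compl_eq)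
    moreover have "Q r = A \<inter> {S. \<not> P r S}"
      by (auto simp: Q_def)
    ultimately show ?thesis
      by (simp add: closedin_closed_Int)
  qed
  have "completely_metrizable_space ?X"
    using assms(1)
    by (intro completely_metrizable_space_closedin completely_metrizable_space_euclidean) simp
  moreover have "?X interior_of \<Union> (range Q) \<noteq> {}"
  proof -
    have "S \<in> \<Union> (range Q)" if S: "S \<in> A" for S
    proof -
      obtain B where B: "finite B" "S ` Y \<subseteq> span (Y \<union> B)"
        using fin [OF S] by blast
      \<comment> \<open>The induced rank of \<open>S\<close> is at most \<open>card B\<close>, so
        the sets \<open>Q r\<close> cover \<open>A\<close>.\<close>
      have "\<not> P (Suc (card B)) S"
      proof
        assume "P (Suc (card B)) S"
        then obtain y where "\<forall>i<Suc (card B). y i \<in> Y" "independent_mod Y (Suc (card B)) (\<lambda>i. S (y i))"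
          by (auto simp: P_def)
        then have "Suc (card B) \<le> card B"
          using B by (intro independent_mod_card_le [OF assms(4) B(1)]) auto
        then show False
          by simp
      qed
      then show ?thesis
        using S by (auto simp: Q_def)
    qed
    then have "\<Union> (range Q) = topspace ?X"
      by (auto simp: Q_def)
    then show ?thesis
      using assms(2) by (simp only: interior_of_topspace) simp
  qed
  ultimately have "\<not> (\<forall>n. ?X interior_of (Q n) = {})"
    using Baire_category_alt [of ?X "range Q"] Q by fastforce
  then obtain n where "?X interior_of (Q n) \<noteq> {}"
    by blast
  then obtain V where V: "open V" "V \<inter> A \<noteq> {}" "V \<inter> A \<subseteq> Q n"
    by (fastforce simp: interior_of_def openin_open Int_commute)
  have "r \<le> n" if S: "S \<in> V \<inter> A" and y: "\<forall>i<r. y i \<in> Y" "independent_mod Y r (\<lambda>i. S (y i))" for S r y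
  proof (rule ccontr)
    assume "\<not> r \<le> n"
    then have "n \<le> r"
      by simp
    then have "independent_mod Y n (\<lambda>i. S (y i))"
      using y(2)
    proof (induction r rule: dec_induct)
      case (step k)
      then show ?case
        using independent_mod_Suc [OF assms(4)] by blast
    qed
    with y(1) \<open>n \<le> r\<close> have "P n S"
      unfolding P_def by (meson order_less_le_trans)
    with S V show False
      by (auto simp: Q_def)
  qed
  with V that show thesis
    by blast
qed

text \<open>
  If \<open>S0\<close> has locally maximal rank as a map from \<open>Y\<close> to the quotient by \<open>Y\<close>, then every \<open>S\<close> in \<open>A\<close> maps
  the kernel of \<open>S0\<close> into the range of \<open>S0\<close>: otherwise \<open>S0 + t *\<^sub>R S\<close> would have larger rank for
  small \<open>t > 0\<close>.
\<close>

lemma common_finite_error: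
  fixes A :: "('a::banach \<Rightarrow>\<^sub>L 'a) set"
  assumes "closed A" "subspace A" "closed Y" "subspace Y"
    and fin: "\<And>S. S \<in> A \<Longrightarrow> \<exists>B. finite B \<and> S ` Y \<subseteq> span (Y \<union> B)"
  obtains S0 G F where "S0 \<in> A" "finite G" "finite F" "Y \<subseteq> span ({y \<in> Y. S0 y \<in> Y} \<union> G)"
    "\<And>S y. \<lbrakk>S \<in> A; y \<in> Y; S0 y \<in> Y\<rbrakk> \<Longrightarrow> S y \<in> span (Y \<union> F)"
proof -
  have "A \<noteq> {}"
    using subspace_0 [OF assms(2)] by blast
  obtain V n where V: "open V" "V \<inter> A \<noteq> {}"
    and n: "\<And>S r y. \<lbrakk>S \<in> V \<inter> A; \<forall>i<r. y i \<in> Y; independent_mod Y r (\<lambda>i. S (y i))\<rbrakk> \<Longrightarrow> r \<le> n"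
    using locally_bounded_rank [OF assms(1) \<open>A \<noteq> {}\<close> assms(3,4) fin] by metis
  define P where "P = (\<lambda>r. \<exists>S\<in>V \<inter> A. \<exists>y. (\<forall>i<r. y i \<in> Y) \<and> independent_mod Y r (\<lambda>i. S (y i)))"
  \<comment> \<open>The maximal rank over \<open>V\<close> and \<open>A\<close>; the bound
    \<open>n\<close> ensures that it exists.\<close>
  define r where "r = Greatest P"
  have "P 0"
    using V(2) by (auto simp: P_def independent_mod_def)
  moreover have Pn: "k \<le> n" if "P k" for k
    using that n unfolding P_def by blast
  ultimately have "P r"
    unfolding r_def by (rule GreatestI_nat)
  have max: "k \<le> r" if "P k" for k
    unfolding r_def using that Pn by (rule Greatest_le_nat)
  obtain S0 y where S0: "S0 \<in> V" "S0 \<in> A" and y: "\<forall>i<r. y i \<in> Y" "independent_mod Y r (\<lambda>i. S0 (y i))"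
    using \<open>P r\<close> by (auto simp: P_def)
  define G where "G = y ` {..<r}"
  define F where "F = S0 ` G"
  have F: "F = (\<lambda>i. S0 (y i)) ` {..<r}"
    by (auto simp: F_def G_def)
  \<comment> \<open>A value of \<open>S0\<close> outside this span would extend the family to rank
    \<open>Suc r\<close>.\<close>
  have range: "S0 x \<in> span (Y \<union> F)" if "x \<in> Y" for x
  proof (rule ccontr)
    assume "S0 x \<notin> span (Y \<union> F)"
    then have "independent_mod Y (Suc r) ((\<lambda>i. S0 (y i))(r := S0 x))"
      using y(2) by (intro independent_mod_extend assms(4)) (simp_all add: F)
    moreover have "(\<lambda>i. S0 (y i))(r := S0 x) = (\<lambda>i. S0 ((y(r := x)) i))"
      by auto
    ultimately have "P (Suc r)"
      unfolding P_def using S0 y(1) that by (auto intro!: bexI [of _ S0] exI [of _ "y(r := x)"])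
    then show False
      using max by fastforce
  qed
  have "S x \<in> span (Y \<union> F)" if S: "S \<in> A" and x: "x \<in> Y" "S0 x \<in> Y" for S x
  proof (rule ccontr)
    assume "S x \<notin> span (Y \<union> F)"
    then have ind: "independent_mod Y (Suc r) ((\<lambda>i. S0 (y i))(r := S x))"
      using y(2) by (intro independent_mod_extend assms(4)) (simp_all add: F)
    define f where "f = (\<lambda>t :: real. (\<lambda>i. (S0 + t *\<^sub>R S) (y i))(r := S x))"
    have t0: "((\<lambda>t. t) \<longlongrightarrow> 0) (at_right (0 :: real))"
      by (simp add: tendsto_ident_at)
    have "((\<lambda>t. f t i) \<longlongrightarrow> ((\<lambda>i. S0 (y i))(r := S x)) i) (at_right 0)" for i
    proof (cases "i = r")
      case False
      have "((\<lambda>t. S0 (y i) + t *\<^sub>R S (y i)) \<longlongrightarrow> S0 (y i) + 0 *\<^sub>R S (y i)) (at_right 0)"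
        by (intro tendsto_intros t0)
      with False show ?thesis
        by (simp add: f_def blinfun.bilinear_simps)
    qed (simp add: f_def)
    then have "\<forall>\<^sub>F t in at_right 0. independent_mod Y (Suc r) (f t)"
      by (intro eventually_independent_mod [OF assms(3,4) ind])
    moreover have "\<forall>\<^sub>F t in at_right 0. S0 + t *\<^sub>R S \<in> V"
    proof (rule topological_tendstoD)
      show "((\<lambda>t. S0 + t *\<^sub>R S) \<longlongrightarrow> S0 + 0 *\<^sub>R S) (at_right 0)"
        by (intro tendsto_intros t0)
    qed (use V(1) S0(1) in auto)
    moreover have "\<forall>\<^sub>F t in at_right 0. (0 :: real) < t"
      by (rule eventually_at_right_less)
    ultimately have "\<forall>\<^sub>F t in at_right 0. independent_mod Y (Suc r) (f t) \<and> S0 + t *\<^sub>R S \<in> V \<and> (0 :: real) < t"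
      by eventually_elim simp
    then obtain t :: real where t: "independent_mod Y (Suc r) (f t)" "S0 + t *\<^sub>R S \<in> V" "0 < t"
      using eventually_happens' [OF trivial_limit_at_right_real] by blast
    \<comment> \<open>Since \<open>S0 x\<close> is in \<open>Y\<close>, the operator
      \<open>S0 + t *\<^sub>R S\<close> sends \<open>x / t\<close> to \<open>S x\<close> modulo
      \<open>Y\<close>. So \<open>f t\<close>, which keeps the fixed last entry \<open>S x\<close>
      as \<open>t\<close> tends to 0, is congruent to a family of values of
      \<open>S0 + t *\<^sub>R S\<close> on \<open>Y\<close>.\<close>
    define z where "z = y(r := (1 / t) *\<^sub>R x)"
    have "f t i - (S0 + t *\<^sub>R S) (z i) \<in> Y" for i
    proof (cases "i = r")
      case True
      then have "f t i - (S0 + t *\<^sub>R S) (z i) = - ((1 / t) *\<^sub>R S0 x)"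
        using t(3) by (simp add: f_def z_def blinfun.bilinear_simps algebra_simps)
      then show ?thesis
        using assms(4) x by (simp add: subspace_neg subspace_scale)
    qed (simp add: f_def z_def subspace_0 [OF assms(4)])
    then have "independent_mod Y (Suc r) (f t) \<longleftrightarrow> independent_mod Y (Suc r) (\<lambda>i. (S0 + t *\<^sub>R S) (z i))"
      by (rule independent_mod_cong [OF assms(4)])
    then have "independent_mod Y (Suc r) (\<lambda>i. (S0 + t *\<^sub>R S) (z i))"
      using t(1) by blast
    moreover have "S0 + t *\<^sub>R S \<in> V \<inter> A"
      using t(2) S0 S assms(2) by (simp add: subspace_add subspace_scale)
    moreover have "\<forall>i<Suc r. z i \<in> Y"
      using y(1) x assms(4) by (simp add: z_def subspace_scale)
    ultimately have "P (Suc r)"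
      unfolding P_def by blast
    then show False
      using max by fastforce
  qed
  \<comment> \<open>The part of \<open>S0 x\<close> in \<open>span F\<close> equals
    \<open>S0 g\<close> for some \<open>g\<close> in \<open>span G\<close>; subtracting
    \<open>g\<close> moves \<open>x\<close> into the kernel modulo \<open>Y\<close>.\<close>
  moreover have "Y \<subseteq> span ({x \<in> Y. S0 x \<in> Y} \<union> G)"
  proof
    fix x
    assume "x \<in> Y"
    then obtain w u where wu: "S0 x = w + u" "w \<in> Y" "u \<in> span F"
      using range [OF \<open>x \<in> Y\<close>] assms(4) by (auto simp: span_Un span_eq_iff [THEN iffD2])
    moreover have "span F = S0 ` span G"
      unfolding F_def
      by (rule linear_span_image) (rule bounded_linear.linear [OF blinfun.bounded_linear_right])
    ultimately obtain g where g: "g \<in> span G" "u = S0 g"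
      by blast
    have "span G \<subseteq> Y"
      using y(1) by (intro span_minimal assms(4)) (auto simp: G_def)
    then have "x - g \<in> Y"
      using g \<open>x \<in> Y\<close> assms(4) by (auto intro: subspace_diff)
    moreover have "S0 (x - g) \<in> Y"
      using wu g by (simp add: blinfun.diff_right)
    ultimately have "x - g \<in> span {x \<in> Y. S0 x \<in> Y}"
      by (simp add: span_base)
    then have "x - g + g \<in> span ({x \<in> Y. S0 x \<in> Y} \<union> G)"
      unfolding span_Un using g(1) by blast
    then show "x \<in> span ({x \<in> Y. S0 x \<in> Y} \<union> G)"
      by simp
  qed
  ultimately show thesis
    using S0(2) by (intro that [of S0 G F]) (auto simp: G_def F_def)
qed

section \<open>The invariant half-space\<close>

context banach_space_over
begin

section \<open>Passing between linear algebra over \<open>'k\<close> and over the reals\<close>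

lemma subspace_imp_real_subspace:
  assumes "subspace Y"
  shows "real_vector.subspace Y"
  using assms unfolding subspace_def real_vector.subspace_def by (auto simp flip: scl_of_real)

lemma real_span_subset_span: "real_vector.span B \<subseteq> span B"
  by (intro real_vector.span_minimal subspace_imp_real_subspace subspace_span span_superset)

text \<open>Each \<open>scl c\<close> is real-linear, so it commutes with taking real spans.\<close>

lemma subspace_real_span:
  assumes "\<And>c x. x \<in> U \<Longrightarrow> scl c x \<in> U"
  shows "subspace (real_vector.span U)"
proof (rule subspaceI)
  fix c x
  assume "x \<in> real_vector.span U"
  then have "scl c x \<in> scl c ` real_vector.span U"
    by blast
  also have "\<dots> = real_vector.span (scl c ` U)"
    by (rule linear_span_image [symmetric]) (rule bounded_linear.linear [OF bounded_linear_scl])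
  also have "\<dots> \<subseteq> real_vector.span U"
    using assms by (intro real_vector.span_mono) auto
  finally show "scl c x \<in> real_vector.span U" .
qed (auto intro: real_vector.span_zero real_vector.span_add)

text \<open>With \<open>1\<close> and \<open>e\<close> spanning \<open>'k\<close> over the reals,
  \<open>B\<close> together with \<open>scl e\<close> applied to \<open>B\<close> suffices.\<close>

lemma span_subset_real_span_finite:
  assumes "finite B"
  obtains C where "finite C" "span B \<subseteq> real_vector.span C"
proof -
  obtain e :: 'k where e: "\<And>c. \<exists>a b. c = of_real a + of_real b * e"
    using real_normed_field_two_generators by blast
  define C where "C = B \<union> scl e ` B"
  have "scl c x \<in> real_vector.span C" if "x \<in> B" for c x
  proof -
    obtain a b where c: "c = of_real a + of_real b * e"
      using e by blast
    have "scl c x = a *\<^sub>R x + b *\<^sub>R scl e x"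
      by (simp add: c scale_left_distrib scl_of_real flip: scale_scale)
    also have "\<dots> \<in> real_vector.span C"
      using that
      by (intro real_vector.span_add real_vector.span_scale real_vector.span_base) (auto simp: C_def)
    finally show ?thesis .
  qed
  then have "span B \<subseteq> real_vector.span C"
    by (auto simp: span_explicit intro!: real_vector.span_sum)
  with assms show thesis
    by (intro that [of C]) (auto simp: C_def)
qed

lemma finite_dim_subspace_iff:
  assumes "subspace Y"
  shows "finite_dim_subspace Y \<longleftrightarrow> (\<exists>B. finite B \<and> Y \<subseteq> real_vector.span B)"
proof
  assume "finite_dim_subspace Y"
  then show "\<exists>B. finite B \<and> Y \<subseteq> real_vector.span B"
    unfolding finite_dim_subspace_def by (metis span_subset_real_span_finite)
next
  assume "\<exists>B. finite B \<and> Y \<subseteq> real_vector.span B"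
  then obtain B where B: "finite B" "Y \<subseteq> span B"
    using real_span_subset_span by blast
  obtain C where C: "C \<subseteq> Y" "independent C" "Y \<subseteq> span C"
    by (rule maximal_independent_subset)
  have "finite C"
    using independent_span_bound [OF B(1) C(2)] B(2) C(1) by blast
  moreover have "Y = span C"
    using C assms by (simp add: span_minimal subset_antisym)
  ultimately show "finite_dim_subspace Y"
    unfolding finite_dim_subspace_def by blast
qed

lemma finite_codim_iff:
  "finite_codim Y \<longleftrightarrow> (\<exists>B. finite B \<and> (\<forall>x. \<exists>b\<in>real_vector.span B. x - b \<in> Y))"
proof
  assume "finite_codim Y"
  then obtain B where B: "finite B" "\<forall>x. \<exists>b\<in>span B. x - b \<in> Y"
    by (auto simp: finite_codim_def)
  then show "\<exists>B. finite B \<and> (\<forall>x. \<exists>b\<in>real_vector.span B. x - b \<in> Y)"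
    using span_subset_real_span_finite [OF B(1)] by (metis subsetD)
next
  assume "\<exists>B. finite B \<and> (\<forall>x. \<exists>b\<in>real_vector.span B. x - b \<in> Y)"
  then obtain B where "finite B" "\<forall>x. \<exists>b\<in>real_vector.span B. x - b \<in> Y"
    by blast
  with real_span_subset_span [of B] show "finite_codim Y"
    unfolding finite_codim_def by blast
qed

lemma almost_invariant_imp_real:
  assumes "almost_invariant S Y"
  shows "\<exists>B. finite B \<and> S ` Y \<subseteq> real_vector.span (Y \<union> B)"
proof -
  obtain B where B: "finite B" "S ` Y \<subseteq> {y + f |y f. y \<in> Y \<and> f \<in> span B}"
    using assms by (auto simp: almost_invariant_def finite_dim_subspace_def)
  obtain C where C: "finite C" "span B \<subseteq> real_vector.span C"
    using span_subset_real_span_finite [OF B(1)] by blast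
  have "S ` Y \<subseteq> real_vector.span (Y \<union> C)"
    using B(2) C(2) unfolding real_vector.span_Un by (blast intro: real_vector.span_base)
  with C(1) show ?thesis
    by blast
qed

section \<open>Construction of the invariant half-space\<close>

lemma invariant_half_space_of_almost_invariant:
  assumes A: "subalgebra A" "closed A"
    and Y: "half_space Y" "\<And>S. S \<in> A \<Longrightarrow> almost_invariant S Y"
  shows "\<exists>Z. half_space Z \<and> (\<forall>S\<in>A. invariant S Z)"
proof -
  have A_op: "A \<subseteq> operators"
    using A(1) by (simp add: subalgebra_def)
  have "r *\<^sub>R S = scale_op (of_real r) S" for r S
    by (rule blinfun_eqI) (simp add: scl_of_real blinfun.scaleR_left)
  then have "real_vector.subspace A"
    using A(1) by (auto simp: subalgebra_def real_vector.subspace_def)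
  have sub: "subspace Y" and closed: "closed Y"
    using Y(1) by (auto simp: half_space_def)
  then have real_sub: "real_vector.subspace Y"
    by (intro subspace_imp_real_subspace)
  obtain S0 G F where S0: "S0 \<in> A" and fin: "finite G" "finite F"
    and G: "Y \<subseteq> real_vector.span ({y \<in> Y. S0 y \<in> Y} \<union> G)"
    and F: "\<And>S y. \<lbrakk>S \<in> A; y \<in> Y; S0 y \<in> Y\<rbrakk> \<Longrightarrow> S y \<in> real_vector.span (Y \<union> F)"
    using common_finite_error [OF A(2) \<open>real_vector.subspace A\<close> closed real_sub
        almost_invariant_imp_real [OF Y(2)]] by blast
  define W where "W = {y \<in> Y. S0 y \<in> Y}"
  \<comment> \<open>\<open>U\<close> is stable under \<open>scl\<close> and, as \<open>A\<close> is
    closed under composition, under every operator in \<open>A\<close>. Its real span therefore is a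
    subspace over \<open>'k\<close> and invariant.\<close>
  define U where "U = W \<union> (\<Union>S\<in>A. blinfun_apply S ` W)"
  define Z where "Z = real_vector.span U"
  have "closed (blinfun_apply S0 -` Y)"
    by (intro closed_vimage closed continuous_intros)
  moreover have "W = Y \<inter> blinfun_apply S0 -` Y"
    by (auto simp: W_def)
  ultimately have "closed W"
    using closed by auto
  have scl_W: "scl c x \<in> W" if "x \<in> W" for c x
    using that sub S0 A_op by (auto simp: W_def operators_def subspace_scale)
  have "real_vector.subspace W"
    using real_sub by (auto simp: W_def real_vector.subspace_def blinfun.add_right blinfun.scaleR_right)
  have "W \<subseteq> Z"
    by (auto simp: Z_def U_def intro: real_vector.span_base)
  have "Y \<subseteq> real_vector.span (W \<union> (G \<union> F))"
    using G real_vector.span_mono [of "W \<union> G" "W \<union> (G \<union> F)"] unfolding W_def by blast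
  moreover have "F \<subseteq> real_vector.span (W \<union> (G \<union> F))"
    by (auto intro: real_vector.span_base)
  ultimately have YF: "real_vector.span (Y \<union> F) \<subseteq> real_vector.span (W \<union> (G \<union> F))"
    by (intro real_vector.span_minimal) auto
  have "Z \<subseteq> real_vector.span (Y \<union> F)"
    unfolding Z_def U_def
    by (intro real_vector.span_minimal) (auto simp: W_def intro: real_vector.span_base F)
  have "closed Z"
    using \<open>closed W\<close> \<open>real_vector.subspace W\<close> \<open>W \<subseteq> Z\<close> \<open>Z \<subseteq> real_vector.span (Y \<union> F)\<close> YF fin
    by (intro closed_finite_extension [of W Z "G \<union> F"]) (auto simp: Z_def)
  moreover have "subspace Z"
    unfolding Z_def
  proof (rule subspace_real_span)
    fix c x
    assume "x \<in> U"
    then consider "x \<in> W" | S w where "S \<in> A" "w \<in> W" "x = S w"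
      by (auto simp: U_def)
    then show "scl c x \<in> U"
    proof cases
      case 2
      then have "scl c x = S (scl c w)"
        using A_op by (auto simp: operators_def)
      then show ?thesis
        using 2 scl_W by (auto simp: U_def)
    qed (simp add: U_def scl_W)
  qed
  \<comment> \<open>\<open>Z\<close> contains \<open>W\<close>, and \<open>W\<close> together with
    the finite set \<open>G\<close> spans \<open>Y\<close>.\<close>
  moreover have "\<not> finite_dim_subspace Z"
  proof
    assume "finite_dim_subspace Z"
    then obtain B where B: "finite B" "Z \<subseteq> real_vector.span B"
      using finite_dim_subspace_iff [OF \<open>subspace Z\<close>] by blast
    then have "W \<union> G \<subseteq> real_vector.span (B \<union> G)"
      using \<open>W \<subseteq> Z\<close> by (auto intro: real_vector.span_base subsetD [OF real_vector.span_mono, of B])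
    then have "Y \<subseteq> real_vector.span (B \<union> G)"
      using G unfolding W_def [symmetric]
      by (meson real_vector.span_minimal real_vector.subspace_span order_trans)
    then have "finite_dim_subspace Y"
      using finite_dim_subspace_iff [OF sub] B(1) fin(1) by blast
    then show False
      using Y(1) by (simp add: half_space_def)
  qed
  \<comment> \<open>\<open>Z\<close> exceeds \<open>Y\<close> by at most \<open>span F\<close>, so
    adding \<open>F\<close> to a finite set that spans modulo \<open>Z\<close> gives one that spans
    modulo \<open>Y\<close>.\<close>
  moreover have "\<not> finite_codim Z"
  proof
    assume "finite_codim Z"
    then obtain B where B: "finite B" "\<And>x. \<exists>b\<in>real_vector.span B. x - b \<in> Z"
      using finite_codim_iff by blast
    have "\<exists>b\<in>real_vector.span (B \<union> F). x - b \<in> Y" for x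
    proof -
      obtain b where b: "b \<in> real_vector.span B" "x - b \<in> Z"
        using B(2) by blast
      then obtain y f where yf: "x - b = y + f" "y \<in> Y" "f \<in> real_vector.span F"
        using \<open>Z \<subseteq> real_vector.span (Y \<union> F)\<close> real_sub
        by (auto simp: real_vector.span_Un real_vector.span_eq_iff [THEN iffD2])
      then have "x - (b + f) \<in> Y"
        by (simp add: algebra_simps)
      moreover have "b + f \<in> real_vector.span (B \<union> F)"
        using b(1) yf(3) unfolding real_vector.span_Un by blast
      ultimately show ?thesis
        by blast
    qed
    then have "finite_codim Y"
      using finite_codim_iff B(1) fin(2) by blast
    then show False
      using Y(1) by (simp add: half_space_def)
  qed
  moreover have "invariant S Z" if S: "S \<in> A" for S
  proof -
    have "S ` Z = real_vector.span (S ` U)"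
      unfolding Z_def
      by (rule linear_span_image [symmetric]) (rule bounded_linear.linear [OF blinfun.bounded_linear_right])
    also have "\<dots> \<subseteq> Z"
      unfolding Z_def
    proof (rule real_vector.span_mono, rule image_subsetI)
      fix x
      assume "x \<in> U"
      then consider "x \<in> W" | R w where "R \<in> A" "w \<in> W" "x = R w"
        by (auto simp: U_def)
      then show "S x \<in> U"
      proof cases
        case 2
        then have "S o\<^sub>L R \<in> A" "S x = (S o\<^sub>L R) w"
          using A(1) S by (auto simp: subalgebra_def)
        then show ?thesis
          using 2(2) unfolding U_def by blast
      qed (use S in \<open>auto simp: U_def\<close>)
    qed
    finally show ?thesis
      by (simp add: invariant_def)
  qed
  ultimately show ?thesis
    unfolding half_space_def by blast
qed

end

theorem theorem3p7:
  fixes scl :: "'k::real_normed_field \<Rightarrow> 'a::banach \<Rightarrow> 'a"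
    and T :: "nat \<Rightarrow> 'a \<Rightarrow>\<^sub>L 'a"
    and n :: nat
    and \<AA> :: "('a \<Rightarrow>\<^sub>L 'a) set"
  assumes "banach_space_over scl"
    and "\<And>i. i \<in> {1..n} \<Longrightarrow> T i \<in> banach_space_over.operators scl"
    and "\<And>i j. i \<in> {1..n} \<Longrightarrow> j \<in> {1..n} \<Longrightarrow> T i o\<^sub>L T j = T j o\<^sub>L T i"
    and "\<AA> = banach_space_over.closed_algebra_generated_by scl (T ` {1..n})"
    and "\<exists>Y. banach_space_over.half_space scl Y \<and>
           (\<forall>S\<in>\<AA>. banach_space_over.almost_invariant scl S Y)"
  shows "\<exists>Z. banach_space_over.half_space scl Z \<and>
           (\<forall>S\<in>\<AA>. invariant S Z)"
proof -
  interpret banach_space_over scl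
    by (rule assms(1))
  have "T ` {1..n} \<subseteq> operators"
    using assms(2) by blast
  then have "subalgebra \<AA>" "closed \<AA>"
    unfolding assms(4) by (rule closed_algebra_generated_by)+
  then show ?thesis
    using invariant_half_space_of_almost_invariant assms(5) by blast
qed

end
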